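(* Let $(\Omega,\Sigma,\mu)$ be a finite atomless measure space, let $X$ be a Köthe $F$-space on $(\Omega,\Sigma,\mu)$, let $Z$ be the set of all signs in $X$, and let $Y$ be an $F$-space. Let $T\in\mathcal L(X,Y)$ be a narrow operator such that the closure $K=\overline{T(Z)}$ is a compact subset of $Y$, and let $\varepsilon>0$. Then there exist $n\in\mathbb N$ and a partition $\Omega=\bigsqcup_{k=1}^n A_k$ of $\Omega$ into measurable sets $A_k\in\Sigma$ such that $\|Tx\|\le\varepsilon$ for every $k\le n$ and every sign $x$ with $\operatorname{supp}x\subseteq A_k$.
   Context: All spaces are over the same scalar field $\mathbb K\in\{\mathbb R,\mathbb C\}$. $\mathcal L(X,Y)$ denotes the space of all continuous linear operators $X\to Y$. $\Sigma^+$ is the set of all $A\in\Sigma$ with $\mu(A)>0$. $L_0(\mu)$ is the linear space of all equivalence classes of $\Sigma$-measurable functions $x:\Omega\to\mathbb K$; $\mathbf 1_A$ is the characteristic function of $A\in\Sigma$. The symbol $\bigsqcup$ denotes a disjoint union. An $F$-space is a complete metric linear space with a translation-invariant metric $\rho$; its $F$-norm is $\|x\|=\rho(x,0)$. It is assumed throughout that $\|\alpha x\|\le\|x\|$ for every vector $x$ and every scalar $\alpha$ with $|\alpha|\le 1$. A Köthe $F$-space on $(\Omega,\Sigma,\mu)$ is an $F$-space $X$ that is a linear subspace of $L_0(\mu)$, such that $\mathbf 1_\Omega\in X$, and such that for all $x\in L_0(\mu)$ and $y\in X$ the condition $|x|\le|y|$ implies $x\in X$ and $\|x\|\le\|y\|$.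 A sign is a $\{-1,0,1\}$-valued element $x\in L_0(\mu)$. It is a sign on $A\in\Sigma$ if $\operatorname{supp}x=A$ (up to null sets). It is of mean zero if $\int x\,d\mu=0$. An operator $T\in\mathcal L(X,Y)$ is narrow if for every $A\in\Sigma^+$ and every $\varepsilon>0$ there is a mean zero sign $x$ on $A$ with $\|Tx\|<\varepsilon$. *)

theory Defs
  imports "HOL-Analysis.Analysis"
begin

text \<open>
  The scalar field is a type of sort \<open>{real_normed_field, euclidean_space}\<close>.  Both \<open>real\<close> and
  \<open>complex\<close> are of this sort, and by the Gelfand--Mazur theorem every type of this sort is
  isomorphic, as a normed field, to one of them.
\<close>

text \<open>
  An \<open>F\<close>-space with an explicit carrier \<open>V\<close>, so that the same notion applies to sets of equivalence
  classes of functions and to types (with \<open>V = UNIV\<close>).  The \<open>F\<close>-norm is \<open>d x zero\<close>; the last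
  axiom is the standing assumption that it does not increase under multiplication by scalars of
  modulus at most 1.
\<close>

locale F_space = Metric_space V d
  for V :: "'v set" and d :: "'v \<Rightarrow> 'v \<Rightarrow> real" +
  fixes add :: "'v \<Rightarrow> 'v \<Rightarrow> 'v"
    and zero :: 'v
    and scale :: "'k::{real_normed_field,euclidean_space} \<Rightarrow> 'v \<Rightarrow> 'v"
  assumes zero_closed: "zero \<in> V"
    and add_closed: "x \<in> V \<Longrightarrow> y \<in> V \<Longrightarrow> add x y \<in> V"
    and scale_closed: "x \<in> V \<Longrightarrow> scale a x \<in> V"
    and add_assoc: "x \<in> V \<Longrightarrow> y \<in> V \<Longrightarrow> z \<in> V \<Longrightarrow> add (add x y) z = add x (add y z)"
    and add_commute: "x \<in> V \<Longrightarrow> y \<in> V \<Longrightarrow> add x y = add y x"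
    and add_zero: "x \<in> V \<Longrightarrow> add x zero = x"
    and add_inverse: "x \<in> V \<Longrightarrow> \<exists>y\<in>V. add x y = zero"
    and scale_add_right: "x \<in> V \<Longrightarrow> y \<in> V \<Longrightarrow> scale a (add x y) = add (scale a x) (scale a y)"
    and scale_add_left: "x \<in> V \<Longrightarrow> scale (a + b) x = add (scale a x) (scale b x)"
    and scale_scale: "x \<in> V \<Longrightarrow> scale a (scale b x) = scale (a * b) x"
    and scale_one: "x \<in> V \<Longrightarrow> scale 1 x = x"
    and continuous_add:
      "continuous_map (prod_topology mtopology mtopology) mtopology (\<lambda>(x, y). add x y)"
    and continuous_scale:
      "continuous_map (prod_topology euclidean mtopology) mtopology (\<lambda>(a, x). scale a x)"
    and complete: "mcomplete"
    and translation_invariant: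
      "x \<in> V \<Longrightarrow> y \<in> V \<Longrightarrow> z \<in> V \<Longrightarrow> d (add x z) (add y z) = d x y"
    and scale_norm_le: "x \<in> V \<Longrightarrow> norm a \<le> 1 \<Longrightarrow> d (scale a x) zero \<le> d x zero"


definition atomless :: "'a measure \<Rightarrow> bool" where
  "atomless M \<longleftrightarrow>
     (\<forall>A\<in>sets M. 0 < emeasure M A \<longrightarrow>
        (\<exists>B\<in>sets M. B \<subseteq> A \<and> 0 < emeasure M B \<and> emeasure M B < emeasure M A))"


definition ae_eq_rel ::
  "'a measure \<Rightarrow> (('a \<Rightarrow> 'k) \<times> ('a \<Rightarrow> 'k::{real_normed_field,euclidean_space})) set" where
  "ae_eq_rel M = {(f, g). f \<in> borel_measurable M \<and> g \<in> borel_measurable M \<and> (AE w in M. f w = g w)}"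

definition L0 :: "'a measure \<Rightarrow> ('a \<Rightarrow> 'k::{real_normed_field,euclidean_space}) set set" where
  "L0 M = borel_measurable M // ae_eq_rel M"

definition L0_class ::
  "'a measure \<Rightarrow> ('a \<Rightarrow> 'k::{real_normed_field,euclidean_space}) \<Rightarrow> ('a \<Rightarrow> 'k) set" where
  "L0_class M f = ae_eq_rel M `` {f}"

text \<open>
  Operations and relations on equivalence classes are given through some representatives; the
  lemmas below show that they do not depend on this choice.
\<close>

definition L0_add ::
  "'a measure \<Rightarrow> ('a \<Rightarrow> 'k::{real_normed_field,euclidean_space}) set \<Rightarrow> ('a \<Rightarrow> 'k) set \<Rightarrow> ('a \<Rightarrow> 'k) set"
  where "L0_add M x y = (\<Union>f\<in>x. \<Union>g\<in>y. L0_class M (\<lambda>w. f w + g w))"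

definition L0_scale ::
  "'a measure \<Rightarrow> 'k::{real_normed_field,euclidean_space} \<Rightarrow> ('a \<Rightarrow> 'k) set \<Rightarrow> ('a \<Rightarrow> 'k) set" where
  "L0_scale M a x = (\<Union>f\<in>x. L0_class M (\<lambda>w. a * f w))"

definition L0_zero :: "'a measure \<Rightarrow> ('a \<Rightarrow> 'k::{real_normed_field,euclidean_space}) set" where
  "L0_zero M = L0_class M (\<lambda>_. 0)"

definition L0_abs_le ::
  "'a measure \<Rightarrow> ('a \<Rightarrow> 'k::{real_normed_field,euclidean_space}) set \<Rightarrow> ('a \<Rightarrow> 'k) set \<Rightarrow> bool" where
  "L0_abs_le M x y \<longleftrightarrow> (\<exists>f\<in>x. \<exists>g\<in>y. AE w in M. norm (f w) \<le> norm (g w))"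

definition L0_supp_eq ::
  "'a measure \<Rightarrow> ('a \<Rightarrow> 'k::{real_normed_field,euclidean_space}) set \<Rightarrow> 'a set \<Rightarrow> bool" where
  "L0_supp_eq M x A \<longleftrightarrow> (\<exists>f\<in>x. AE w in M. f w \<noteq> 0 \<longleftrightarrow> w \<in> A)"

definition L0_supp_subset ::
  "'a measure \<Rightarrow> ('a \<Rightarrow> 'k::{real_normed_field,euclidean_space}) set \<Rightarrow> 'a set \<Rightarrow> bool" where
  "L0_supp_subset M x A \<longleftrightarrow> (\<exists>f\<in>x. AE w in M. f w \<noteq> 0 \<longrightarrow> w \<in> A)"

definition is_sign ::
  "'a measure \<Rightarrow> ('a \<Rightarrow> 'k::{real_normed_field,euclidean_space}) set \<Rightarrow> bool" where
  "is_sign M x \<longleftrightarrow> x \<in> L0 M \<and> (\<exists>f\<in>x. AE w in M. f w \<in> {-1, 0, 1})"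

definition mean_zero ::
  "'a measure \<Rightarrow> ('a \<Rightarrow> 'k::{real_normed_field,euclidean_space}) set \<Rightarrow> bool" where
  "mean_zero M x \<longleftrightarrow> (\<exists>f\<in>x. integrable M f \<and> (\<integral>w. f w \<partial>M) = 0)"


lemma equiv_ae_eq_rel: "equiv (borel_measurable M) (ae_eq_rel M)"
  by (rule equivI) (auto simp: ae_eq_rel_def refl_on_def sym_def trans_def elim: AE_mp)

lemma mem_L0_class_iff:
  "f \<in> borel_measurable M \<Longrightarrow>
     g \<in> L0_class M f \<longleftrightarrow> g \<in> borel_measurable M \<and> (AE w in M. g w = f w)"
  by (auto simp: L0_class_def ae_eq_rel_def eq_commute)

lemma L0_eq: "L0 M = L0_class M ` borel_measurable M"
  by (auto simp: L0_def L0_class_def quotient_def)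

lemma L0_class_eq_iff:
  assumes "f \<in> borel_measurable M" "g \<in> borel_measurable M"
  shows "L0_class M f = L0_class M g \<longleftrightarrow> (AE w in M. f w = g w)"
  unfolding L0_class_def
  using eq_equiv_class_iff[OF equiv_ae_eq_rel assms] assms by (simp add: ae_eq_rel_def)

lemma self_in_L0_class: "f \<in> borel_measurable M \<Longrightarrow> f \<in> L0_class M f"
  by (simp add: mem_L0_class_iff)

lemma L0_add_class:
  assumes f: "f \<in> borel_measurable M" and g: "g \<in> borel_measurable M"
  shows "L0_add M (L0_class M f) (L0_class M g) = L0_class M (\<lambda>w. f w + g w)"
proof -
  have "L0_class M (\<lambda>w. f' w + g' w) = L0_class M (\<lambda>w. f w + g w)"
    if "f' \<in> L0_class M f" "g' \<in> L0_class M g" for f' g'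
    using that f g by (subst L0_class_eq_iff) (auto simp: mem_L0_class_iff)
  then show ?thesis
    using self_in_L0_class[OF f] self_in_L0_class[OF g] unfolding L0_add_def by blast
qed

lemma L0_scale_class:
  assumes f: "f \<in> borel_measurable M"
  shows "L0_scale M a (L0_class M f) = L0_class M (\<lambda>w. a * f w)"
proof -
  have "L0_class M (\<lambda>w. a * f' w) = L0_class M (\<lambda>w. a * f w)" if "f' \<in> L0_class M f" for f'
    using that f by (subst L0_class_eq_iff) (auto simp: mem_L0_class_iff)
  then show ?thesis
    using self_in_L0_class[OF f] unfolding L0_scale_def by blast
qed

lemma L0_abs_le_class:
  assumes f: "f \<in> borel_measurable M" and g: "g \<in> borel_measurable M"
  shows "L0_abs_le M (L0_class M f) (L0_class M g) \<longleftrightarrow> (AE w in M. norm (f w) \<le> norm (g w))"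
proof
  assume "L0_abs_le M (L0_class M f) (L0_class M g)"
  then obtain f' g' where "AE w in M. f' w = f w" "AE w in M. g' w = g w"
    "AE w in M. norm (f' w) \<le> norm (g' w)"
    using f g by (auto simp: L0_abs_le_def mem_L0_class_iff)
  then show "AE w in M. norm (f w) \<le> norm (g w)"
    by eventually_elim simp
qed (use self_in_L0_class[OF f] self_in_L0_class[OF g] in \<open>auto simp: L0_abs_le_def\<close>)

lemma L0_supp_eq_class:
  assumes f: "f \<in> borel_measurable M"
  shows "L0_supp_eq M (L0_class M f) A \<longleftrightarrow> (AE w in M. f w \<noteq> 0 \<longleftrightarrow> w \<in> A)"
proof
  assume "L0_supp_eq M (L0_class M f) A"
  then obtain f' where "AE w in M. f' w = f w" "AE w in M. f' w \<noteq> 0 \<longleftrightarrow> w \<in> A"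
    using f by (auto simp: L0_supp_eq_def mem_L0_class_iff)
  then show "AE w in M. f w \<noteq> 0 \<longleftrightarrow> w \<in> A"
    by eventually_elim simp
qed (use self_in_L0_class[OF f] in \<open>auto simp: L0_supp_eq_def\<close>)

lemma L0_supp_subset_class:
  assumes f: "f \<in> borel_measurable M"
  shows "L0_supp_subset M (L0_class M f) A \<longleftrightarrow> (AE w in M. f w \<noteq> 0 \<longrightarrow> w \<in> A)"
proof
  assume "L0_supp_subset M (L0_class M f) A"
  then obtain f' where "AE w in M. f' w = f w" "AE w in M. f' w \<noteq> 0 \<longrightarrow> w \<in> A"
    using f by (auto simp: L0_supp_subset_def mem_L0_class_iff)
  then show "AE w in M. f w \<noteq> 0 \<longrightarrow> w \<in> A"
    by eventually_elim simp
qed (use self_in_L0_class[OF f] in \<open>auto simp: L0_supp_subset_def\<close>)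

lemma is_sign_class:
  assumes f: "f \<in> borel_measurable M"
  shows "is_sign M (L0_class M f) \<longleftrightarrow> (AE w in M. f w \<in> {-1, 0, 1})"
proof
  assume "is_sign M (L0_class M f)"
  then obtain f' where "AE w in M. f' w = f w" "AE w in M. f' w \<in> {-1, 0, 1}"
    using f by (auto simp: is_sign_def mem_L0_class_iff)
  then show "AE w in M. f w \<in> {-1, 0, 1}"
    by eventually_elim simp
qed (use self_in_L0_class[OF f] f in \<open>auto simp: is_sign_def L0_eq\<close>)

lemma mean_zero_class:
  assumes f: "f \<in> borel_measurable M"
  shows "mean_zero M (L0_class M f) \<longleftrightarrow> integrable M f \<and> (\<integral>w. f w \<partial>M) = 0"
proof
  assume "mean_zero M (L0_class M f)"
  then obtain f' where f': "f' \<in> borel_measurable M" "AE w in M. f' w = f w"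
    "integrable M f'" "(\<integral>w. f' w \<partial>M) = 0"
    using f by (auto simp: mean_zero_def mem_L0_class_iff)
  then show "integrable M f \<and> (\<integral>w. f w \<partial>M) = 0"
    using f integrable_cong_AE[OF f'(1) f f'(2)] integral_cong_AE[OF f'(1) f f'(2)] by simp
qed (use self_in_L0_class[OF f] in \<open>auto simp: mean_zero_def\<close>)


definition Koethe_F_space ::
  "'a measure \<Rightarrow> ('a \<Rightarrow> 'k::{real_normed_field,euclidean_space}) set set \<Rightarrow>
     (('a \<Rightarrow> 'k) set \<Rightarrow> ('a \<Rightarrow> 'k) set \<Rightarrow> real) \<Rightarrow> bool" where
  "Koethe_F_space M X d \<longleftrightarrow>
     X \<subseteq> L0 M \<and>
     F_space X d (L0_add M) (L0_zero M) (L0_scale M) \<and>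
     L0_class M (indicator (space M)) \<in> X \<and>
     (\<forall>x\<in>L0 M. \<forall>y\<in>X. L0_abs_le M x y \<longrightarrow> x \<in> X \<and> d x (L0_zero M) \<le> d y (L0_zero M))"

text \<open>
  Continuous linear operators from \<open>(X, d)\<close> to a space \<open>Y\<close> given by a type with scalar
  multiplication \<open>sY\<close>; the values of \<open>T\<close> outside \<open>X\<close> are irrelevant.
\<close>

definition continuous_linear_operator ::
  "'a measure \<Rightarrow> ('a \<Rightarrow> 'k::{real_normed_field,euclidean_space}) set set \<Rightarrow>
     (('a \<Rightarrow> 'k) set \<Rightarrow> ('a \<Rightarrow> 'k) set \<Rightarrow> real) \<Rightarrow>
     ('k \<Rightarrow> 'y \<Rightarrow> 'y::{ab_group_add,metric_space}) \<Rightarrow> (('a \<Rightarrow> 'k) set \<Rightarrow> 'y) \<Rightarrow> bool" where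
  "continuous_linear_operator M X d sY T \<longleftrightarrow>
     (\<forall>x\<in>X. \<forall>y\<in>X. T (L0_add M x y) = T x + T y) \<and>
     (\<forall>a. \<forall>x\<in>X. T (L0_scale M a x) = sY a (T x)) \<and>
     continuous_map (Metric_space.mtopology X d) euclidean T"

text \<open>
  Over a finite measure space every sign belongs to every Koethe \<open>F\<close>-space, since its modulus is
  at most that of the constant function 1; so \<open>T x\<close> is meaningful below.
\<close>

definition narrow ::
  "'a measure \<Rightarrow> (('a \<Rightarrow> 'k::{real_normed_field,euclidean_space}) set \<Rightarrow> 'y::{ab_group_add,metric_space}) \<Rightarrow> bool"
  where
  "narrow M T \<longleftrightarrow>
     (\<forall>A\<in>sets M. 0 < emeasure M A \<longrightarrow> (\<forall>\<epsilon>>0.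
        \<exists>x. is_sign M x \<and> L0_supp_eq M x A \<and> mean_zero M x \<and> dist (T x) 0 < \<epsilon>))"

end

theory Submission
  imports Defs
begin

text \<open>
  If \<open>n\<close> disjointly supported signs have images in a small ball around \<open>z\<close>, then their sum is again
  a sign whose image is close to \<open>n z\<close>; as \<open>K\<close> is compact, hence bounded, \<open>z\<close> must be small.  So
  the number of disjointly supported signs with \<open>\<parallel>T x\<parallel> > \<epsilon>\<close> is bounded.  Take a family
  \<open>y\<^sub>1, \<dots>, y\<^sub>N\<close> of such signs with \<open>N\<close> maximal.  Narrowness halves \<open>T \<one>\<^sub>P\<close> up to any error, so
  iterated halving cuts the support of \<open>y\<^sub>j\<close> into pieces \<open>B\<close> with
  \<open>\<parallel>T (y\<^sub>j \<one>\<^sub>B)\<parallel> < \<parallel>T y\<^sub>j\<parallel> - \<epsilon>\<close>.  A sign \<open>z\<close> supported in \<open>B\<close> with \<open>\<parallel>T z\<parallel> > \<epsilon>\<close> would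
  allow replacing \<open>y\<^sub>j\<close> by the two signs \<open>y\<^sub>j - y\<^sub>j \<one>\<^sub>B\<close> and \<open>z\<close>, against maximality.
\<close>

subsection \<open>\<open>F\<close>-spaces on a type\<close>

text \<open>Taking \<open>UNIV\<close> as carrier removes all membership side conditions, and taking
  \<open>dist\<close> as metric makes \<open>compact\<close>, \<open>closure\<close> and
  \<open>ball\<close> of the type refer to the F-norm.\<close>

locale F_space_type = F_space "UNIV :: 'y set" dist "(+)" 0 scale
  for scale :: "'k::{real_normed_field,euclidean_space} \<Rightarrow> 'y::{ab_group_add,metric_space} \<Rightarrow> 'y"
begin

lemma dist_diff_zero: "dist (x - y) 0 = dist x (y :: 'y)"
  using translation_invariant[of "x - y" 0 y] by simp

lemma dist_minus_zero: "dist (- x) 0 = dist x (0 :: 'y)"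
  using dist_diff_zero[of 0 x] by (simp add: dist_commute)

lemma dist_add_add: "dist (a + b) (c + e) \<le> dist a c + dist b (e :: 'y)"
proof -
  have "dist (a + b) (c + b) = dist a c" "dist (b + c) (e + c) = dist b e"
    by (rule translation_invariant; simp)+
  then show ?thesis
    using dist_triangle[of "a + b" "c + e" "c + b"] by (simp add: add.commute)
qed

lemma dist_sum_sum:
  fixes f g :: "'i \<Rightarrow> 'y"
  shows "dist (\<Sum>i\<in>I. f i) (\<Sum>i\<in>I. g i) \<le> (\<Sum>i\<in>I. dist (f i) (g i))"
proof (induction I rule: infinite_finite_induct)
  case (insert i I)
  then show ?case
    using dist_add_add[of "f i" "sum f I" "g i" "sum g I"] by simp
qed auto

lemma scale_zero_left: "scale 0 x = 0"
  using scale_add_left[of x 0 0] by simp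

lemma scale_diff_right: "scale a (x - y) = scale a x - scale a y"
  using scale_add_right[of "x - y" y a] by simp

text \<open>An F-norm need not be homogeneous. Translation invariance turns the standing assumption
  on F-norms into this nonexpansiveness, which replaces homogeneity in all later estimates.\<close>

lemma dist_scale_scale: "norm a \<le> 1 \<Longrightarrow> dist (scale a x) (scale a y) \<le> dist x y"
  using scale_norm_le[of "x - y" a] by (simp add: dist_diff_zero scale_diff_right)

lemma sum_constant_eq_scale: "finite I \<Longrightarrow> (\<Sum>i\<in>I. x) = scale (of_nat (card I)) x"
  by (induction I rule: finite_induct) (simp_all add: scale_zero_left scale_add_left scale_one)

lemma tendsto_scale:
  assumes "(f \<longlongrightarrow> a) F" "(g \<longlongrightarrow> x) F"
  shows "((\<lambda>i. scale (f i) (g i)) \<longlongrightarrow> scale a x) F"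
proof -
  have "continuous_on UNIV (\<lambda>(a, x). scale a x)"
    using continuous_scale by (simp add: euclidean_product_topology)
  then have "isCont (\<lambda>(a, x). scale a x) (a, x)"
    by (simp add: continuous_on_eq_continuous_at)
  from isCont_tendsto_compose[OF this tendsto_Pair[OF assms]] show ?thesis
    by simp
qed

text \<open>A compact set is bounded in the linear sense, which boundedness of the F-norm alone
  would not give. Otherwise some \<open>s n\<close> in \<open>K\<close> violate the bound for
  \<open>1 / Suc n\<close>; along a convergent subsequence, joint continuity of \<open>scale\<close>
  forces the products to tend to \<open>scale 0 l = 0\<close>.\<close>

lemma compact_imp_scale_small:
  assumes "compact K" "\<delta> > 0"
  obtains n :: nat where "n > 0" "\<And>s. s \<in> K \<Longrightarrow> dist (scale (1 / of_nat n) s) 0 < \<delta>"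
proof -
  have "\<exists>n>0. \<forall>s\<in>K. dist (scale (1 / of_nat n) s) 0 < \<delta>"
  proof (rule ccontr)
    assume "\<not> ?thesis"
    then have "\<forall>n. \<exists>s\<in>K. dist (scale (1 / of_nat (Suc n)) s) 0 \<ge> \<delta>"
      by (meson not_le zero_less_Suc)
    then obtain s where s: "\<And>n. s n \<in> K" "\<And>n. dist (scale (1 / of_nat (Suc n)) (s n)) 0 \<ge> \<delta>"
      by meson
    obtain l r where r: "strict_mono r" "(s \<circ> r) \<longlonglongrightarrow> l"
      using \<open>compact K\<close> s(1) unfolding compact_def by blast
    have "(\<lambda>n. 1 / of_nat (Suc n) :: 'k) \<longlonglongrightarrow> 0"
      by (rule tendsto_norm_zero_cancel)
        (use LIMSEQ_inverse_real_of_nat in \<open>simp only: norm_divide norm_of_nat norm_one inverse_eq_divide\<close>)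
    from LIMSEQ_subseq_LIMSEQ[OF this r(1)]
    have "(\<lambda>n. scale (1 / of_nat (Suc (r n))) (s (r n))) \<longlonglongrightarrow> scale 0 l"
      using r(2) by (intro tendsto_scale) (simp_all add: o_def)
    then have "(\<lambda>n. dist (scale (1 / of_nat (Suc (r n))) (s (r n))) 0) \<longlonglongrightarrow> 0"
      unfolding scale_zero_left by (rule iffD1[OF tendsto_dist_iff])
    then have "\<delta> \<le> 0"
      by (rule LIMSEQ_le_const) (use s(2) in blast)
    with \<open>\<delta> > 0\<close> show False
      by simp
  qed
  then show ?thesis
    using that by blast
qed

lemma scale_half_power_small:
  assumes "\<delta> > 0"
  obtains m :: nat where "dist (scale ((1 / 2) ^ m) x) 0 < \<delta>"
proof -
  have "(\<lambda>m. (1 / 2) ^ m :: 'k) \<longlonglongrightarrow> 0"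
    by (rule LIMSEQ_power_zero) (simp add: norm_divide)
  then have "(\<lambda>m. scale ((1 / 2) ^ m) x) \<longlonglongrightarrow> scale 0 x"
    by (intro tendsto_scale) auto
  then have "\<forall>\<^sub>F m in sequentially. dist (scale ((1 / 2) ^ m) x) 0 < \<delta>"
    using assms unfolding scale_zero_left by (rule tendstoD)
  then show ?thesis
    using that unfolding eventually_sequentially by blast
qed

end

subsection \<open>Operators on Koethe spaces\<close>

text \<open>The values are restricted at every point, not just almost everywhere, so that
  disjointness of supports and sums of signs can be handled pointwise.\<close>

definition sign_fun :: "'a measure \<Rightarrow> ('a \<Rightarrow> 'k::{real_normed_field,euclidean_space}) \<Rightarrow> bool" where
  "sign_fun M f \<longleftrightarrow> f \<in> borel_measurable M \<and> (\<forall>w. f w \<in> {-1, 0, 1})"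

lemma sign_fun_measurable: "sign_fun M f \<Longrightarrow> f \<in> borel_measurable M"
  by (simp add: sign_fun_def)

lemma sign_fun_norm_le: "sign_fun M f \<Longrightarrow> norm (f w) \<le> 1"
  by (auto simp: sign_fun_def dest!: spec[of _ w])

lemma is_sign_L0_class: "sign_fun M f \<Longrightarrow> is_sign M (L0_class M f)"
  by (subst is_sign_class) (auto simp: sign_fun_def)

lemma is_sign_obtain:
  fixes x :: "('a \<Rightarrow> 'k::{real_normed_field,euclidean_space}) set"
  assumes "is_sign M x" "L0_supp_subset M x A" "A \<in> sets M"
  obtains f where "sign_fun M f" "x = L0_class M f" "\<And>w. f w \<noteq> 0 \<Longrightarrow> w \<in> A"
proof -
  obtain g where g: "g \<in> borel_measurable M" "x = L0_class M g"
    using assms(1) by (auto simp: is_sign_def L0_eq)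
  then have AE: "AE w in M. g w \<in> {-1, 0, 1}" "AE w in M. g w \<noteq> 0 \<longrightarrow> w \<in> A"
    using assms is_sign_class L0_supp_subset_class by blast+
  \<comment> \<open>Resetting \<open>g\<close> to 0 outside \<open>A\<close> and at all values other
    than -1 and 1 changes it only on a null set and makes both almost everywhere conditions hold
    everywhere.\<close>
  define f where "f w = (if w \<in> A \<and> g w \<in> {-1, 1} then g w else 0)" for w
  have [measurable]: "g \<in> borel_measurable M" "A \<in> sets M"
    by fact+
  have f: "f \<in> borel_measurable M"
    unfolding f_def by measurable
  have "AE w in M. g w = f w"
    using AE by eventually_elim (auto simp: f_def)
  then have "x = L0_class M f"
    using g f by (simp add: L0_class_eq_iff)
  moreover have "sign_fun M f"
    using f by (auto simp: sign_fun_def f_def)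
  moreover have "w \<in> A" if "f w \<noteq> 0" for w
    using that by (auto simp: f_def split: if_splits)
  ultimately show ?thesis
    using that by blast
qed

locale Koethe_operator = Y: F_space_type scaleY
  for M :: "'a measure"
    and X :: "('a \<Rightarrow> 'k::{real_normed_field,euclidean_space}) set set"
    and d :: "('a \<Rightarrow> 'k) set \<Rightarrow> ('a \<Rightarrow> 'k) set \<Rightarrow> real"
    and scaleY :: "'k \<Rightarrow> 'y \<Rightarrow> 'y::{ab_group_add,metric_space}"
    and T :: "('a \<Rightarrow> 'k) set \<Rightarrow> 'y" +
  assumes Koethe: "Koethe_F_space M X d"
    and operator: "continuous_linear_operator M X d scaleY T"
begin

sublocale X: F_space X d "L0_add M" "L0_zero M" "L0_scale M"
  using Koethe by (simp add: Koethe_F_space_def)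

definition val :: "('a \<Rightarrow> 'k) \<Rightarrow> 'y" where
  "val f = T (L0_class M f)"

text \<open>\<open>T\<close> is unconstrained outside \<open>X\<close>, so \<open>val\<close> is
  known to be linear only on these functions.\<close>

definition dom :: "('a \<Rightarrow> 'k) set" where
  "dom = {f \<in> borel_measurable M. L0_class M f \<in> X}"

text \<open>This is the ideal property of a Koethe space applied with the constant function 1 as
  majorant.\<close>

lemma bounded_in_dom:
  assumes "f \<in> borel_measurable M" "\<And>w. norm (f w) \<le> 1"
  shows "f \<in> dom"
proof -
  have "L0_class M f \<in> L0 M"
    using assms(1) by (simp add: L0_eq)
  moreover have "L0_abs_le M (L0_class M f) (L0_class M (indicator (space M)))"
    using assms by (subst L0_abs_le_class) (auto intro!: AE_I2)
  ultimately show ?thesis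
    using Koethe assms(1) unfolding Koethe_F_space_def dom_def by blast
qed

lemma sign_fun_in_dom: "sign_fun M f \<Longrightarrow> f \<in> dom"
  by (rule bounded_in_dom[OF sign_fun_measurable sign_fun_norm_le])

lemma indicator_in_dom: "A \<in> sets M \<Longrightarrow> indicator A \<in> dom"
  by (rule bounded_in_dom) (auto simp: indicator_def)

lemma dom_add: "f \<in> dom \<Longrightarrow> g \<in> dom \<Longrightarrow> (\<lambda>w. f w + g w) \<in> dom"
  using X.add_closed[of "L0_class M f" "L0_class M g"] by (auto simp: dom_def L0_add_class)

lemma dom_scale: "f \<in> dom \<Longrightarrow> (\<lambda>w. a * f w) \<in> dom"
  using X.scale_closed[of "L0_class M f" a] by (auto simp: dom_def L0_scale_class)

lemma dom_minus: "f \<in> dom \<Longrightarrow> (\<lambda>w. - f w) \<in> dom"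
  using dom_scale[of f "-1"] by simp

lemma zero_in_dom: "(\<lambda>w. 0) \<in> dom"
  by (rule bounded_in_dom) auto

lemma val_add: "f \<in> dom \<Longrightarrow> g \<in> dom \<Longrightarrow> val (\<lambda>w. f w + g w) = val f + val g"
  using operator by (auto simp: dom_def val_def continuous_linear_operator_def simp flip: L0_add_class)

lemma val_scale: "f \<in> dom \<Longrightarrow> val (\<lambda>w. a * f w) = scaleY a (val f)"
  using operator
  by (auto simp: dom_def val_def continuous_linear_operator_def simp flip: L0_scale_class)

lemma val_zero: "val (\<lambda>w. 0) = 0"
  using val_add[OF zero_in_dom zero_in_dom] by simp

lemma val_minus: "f \<in> dom \<Longrightarrow> val (\<lambda>w. - f w) = - val f"
  using val_add[of f "\<lambda>w. - f w"] dom_minus[of f] by (simp add: val_zero eq_neg_iff_add_eq_0 add.commute)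

lemma val_diff: "f \<in> dom \<Longrightarrow> g \<in> dom \<Longrightarrow> val (\<lambda>w. f w - g w) = val f - val g"
  using val_add[of f "\<lambda>w. - g w"] dom_minus[of g] by (simp add: val_minus)

lemma val_sum:
  assumes "finite I" "\<And>i. i \<in> I \<Longrightarrow> f i \<in> dom"
  shows "(\<lambda>w. \<Sum>i\<in>I. f i w) \<in> dom \<and> val (\<lambda>w. \<Sum>i\<in>I. f i w) = (\<Sum>i\<in>I. val (f i))"
  using assms by (induction I rule: finite_induct) (auto simp: zero_in_dom val_zero dom_add val_add)

lemma val_cong_AE:
  "f \<in> borel_measurable M \<Longrightarrow> g \<in> borel_measurable M \<Longrightarrow> AE w in M. f w = g w \<Longrightarrow> val f = val g"
  unfolding val_def by (metis L0_class_eq_iff)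

subsection \<open>Halving by narrowness\<close>

lemma narrow_obtain:
  assumes "narrow M T" "P \<in> sets M" "\<eta> > 0"
  obtains f where "f \<in> borel_measurable M" "AE w in M. f w \<in> {-1, 0, 1}"
    "AE w in M. f w \<noteq> 0 \<longleftrightarrow> w \<in> P" "dist (val f) 0 < \<eta>"
proof (cases "emeasure M P = 0")
  case True
  \<comment> \<open>Narrowness speaks of sets of positive measure only; on a null set the zero
    function is a sign with the required support. Hence the halving below never has to ask for
    positive measure.\<close>
  then have "AE w in M. w \<notin> P"
    using assms(2) by (intro AE_not_in) auto
  then show ?thesis
    using that[of "\<lambda>_. 0"] \<open>\<eta> > 0\<close> by (simp add: val_zero)
next
  case False
  then obtain x where x: "is_sign M x" "L0_supp_eq M x P" "dist (T x) 0 < \<eta>"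
    using assms unfolding narrow_def by (metis zero_less_iff_neq_zero)
  then obtain f where f: "f \<in> borel_measurable M" "x = L0_class M f"
    by (auto simp: is_sign_def L0_eq)
  then show ?thesis
    using x that[of f] by (simp add: is_sign_class L0_supp_eq_class val_def)
qed

text \<open>For a sign \<open>f\<close> on \<open>P\<close> with small image, the sets where
  \<open>f\<close> is 1 and -1 have indicators \<open>(indicator P + f) / 2\<close> and
  \<open>(indicator P - f) / 2\<close> almost everywhere. Their images therefore differ from half
  the image of \<open>indicator P\<close> by half of \<open>val f\<close> up to sign.\<close>

lemma narrow_halving:
  assumes "narrow M T" and P: "P \<in> sets M" and "\<eta> > 0"
  obtains D E where "D \<in> sets M" "E \<in> sets M" "D \<union> E = P"
    "dist (val (indicator D)) (scaleY (1 / 2) (val (indicator P))) < \<eta>"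
    "dist (val (indicator E)) (scaleY (1 / 2) (val (indicator P))) < \<eta>"
proof -
  obtain f where f [measurable]: "f \<in> borel_measurable M" and AE: "AE w in M. f w \<in> {-1, 0, 1}"
    "AE w in M. f w \<noteq> 0 \<longleftrightarrow> w \<in> P" and small: "dist (val f) 0 < \<eta>"
    using narrow_obtain[OF assms] .
  have [measurable]: "P \<in> sets M"
    by fact
  define D where "D = {w \<in> space M. w \<in> P \<and> f w = 1}"
  \<comment> \<open>As a complement, \<open>E\<close> satisfies \<open>D \<union> E = P\<close>
    exactly, whereas \<open>f = -1\<close> is known only almost everywhere on it.\<close>
  define E where "E = P - D"
  have D [measurable]: "D \<in> sets M"
    unfolding D_def by measurable
  have E [measurable]: "E \<in> sets M"
    unfolding E_def by measurable
  have fdom: "f \<in> dom"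
  proof -
    \<comment> \<open>\<open>f\<close> is bounded by 1 only almost everywhere; \<open>g\<close> is a
      representative of the same class that is bounded everywhere.\<close>
    define g where "g w = (if f w \<in> {-1, 1} then f w else 0)" for w
    have [measurable]: "g \<in> borel_measurable M"
      unfolding g_def by measurable
    have "AE w in M. f w = g w"
      using AE(1) by eventually_elim (auto simp: g_def)
    then have "L0_class M f = L0_class M g"
      by (simp add: L0_class_eq_iff)
    moreover have "g \<in> dom"
      by (rule bounded_in_dom) (auto simp: g_def)
    ultimately show ?thesis
      using f by (simp add: dom_def)
  qed
  have half: "dist (scaleY (1 / 2) y) (scaleY (1 / 2) z) \<le> dist y z" for y z
    by (rule Y.dist_scale_scale) (simp add: norm_divide)
  have "AE w in M. indicator D w = 1 / 2 * (indicator P w + f w)"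
    using AE AE_space by eventually_elim (auto simp: D_def indicator_def)
  then have "val (indicator D) = val (\<lambda>w. 1 / 2 * (indicator P w + f w))"
    by (intro val_cong_AE) auto
  also have "\<dots> = scaleY (1 / 2) (val (indicator P) + val f)"
    using P fdom by (simp only: val_scale dom_add val_add indicator_in_dom)
  finally have "dist (val (indicator D)) (scaleY (1 / 2) (val (indicator P))) \<le>
      dist (val (indicator P) + val f) (val (indicator P) + 0)"
    using half by simp
  also have "\<dots> < \<eta>"
    using Y.dist_add_add[of "val (indicator P)" "val f" "val (indicator P)" 0] small by simp
  finally have 1: "dist (val (indicator D)) (scaleY (1 / 2) (val (indicator P))) < \<eta>" .
  have "AE w in M. indicator E w = 1 / 2 * (indicator P w + - f w)"
    using AE AE_space by eventually_elim (auto simp: D_def E_def indicator_def)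
  then have "val (indicator E) = val (\<lambda>w. 1 / 2 * (indicator P w + - f w))"
    by (intro val_cong_AE) auto
  also have "\<dots> = scaleY (1 / 2) (val (indicator P) + - val f)"
    using P fdom by (simp only: val_scale dom_add dom_minus val_add val_minus indicator_in_dom)
  finally have "dist (val (indicator E)) (scaleY (1 / 2) (val (indicator P))) \<le>
      dist (val (indicator P) + - val f) (val (indicator P) + 0)"
    using half by simp
  also have "\<dots> < \<eta>"
    using Y.dist_add_add[of "val (indicator P)" "- val f" "val (indicator P)" 0] small
    by (simp add: Y.dist_minus_zero)
  finally have 2: "dist (val (indicator E)) (scaleY (1 / 2) (val (indicator P))) < \<eta>" .
  show ?thesis
    using that[OF D E _ 1 2] by (auto simp: E_def D_def)
qed

text \<open>In the induction step \<open>P\<close> is halved with error \<open>\<eta> / 2\<close>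
  and each half is treated by the induction hypothesis, again with error \<open>\<eta> / 2\<close>.
  Multiplication by \<open>(1 / 2) ^ m\<close> does not enlarge the first error, so the two add up
  to at most \<open>\<eta>\<close>.\<close>

lemma narrow_iterated_halving:
  assumes "narrow M T" "P \<in> sets M" "\<eta> > 0"
  shows "\<exists>C. finite C \<and> C \<subseteq> sets M \<and> \<Union>C = P \<and>
    (\<forall>B\<in>C. dist (val (indicator B)) (scaleY ((1 / 2) ^ m) (val (indicator P))) < \<eta>)"
  using assms(2,3)
proof (induction m arbitrary: P \<eta>)
  case 0
  then show ?case
    by (intro exI[of _ "{P}"]) (simp add: Y.scale_one)
next
  case (Suc m)
  obtain D E where DE: "D \<in> sets M" "E \<in> sets M" and P: "D \<union> E = P"
    and D: "dist (val (indicator D)) (scaleY (1 / 2) (val (indicator P))) < \<eta> / 2"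
    and E: "dist (val (indicator E)) (scaleY (1 / 2) (val (indicator P))) < \<eta> / 2"
    using narrow_halving[OF assms(1) Suc.prems(1) half_gt_zero[OF Suc.prems(2)]] .
  have step: "\<exists>C. finite C \<and> C \<subseteq> sets M \<and> \<Union>C = D \<and>
      (\<forall>B\<in>C. dist (val (indicator B)) (scaleY ((1 / 2) ^ Suc m) (val (indicator P))) < \<eta>)"
    if D: "D \<in> sets M" "dist (val (indicator D)) (scaleY (1 / 2) (val (indicator P))) < \<eta> / 2" for D
  proof -
    obtain C where C: "finite C" "C \<subseteq> sets M" "\<Union>C = D"
      "\<And>B. B \<in> C \<Longrightarrow> dist (val (indicator B)) (scaleY ((1 / 2) ^ m) (val (indicator D))) < \<eta> / 2"
      using Suc.IH[OF D(1), of "\<eta> / 2"] Suc.prems(2) by auto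
    have "norm ((1 / 2) ^ m :: 'k) \<le> 1"
      by (simp add: norm_power norm_divide power_le_one)
    then have "dist (scaleY ((1 / 2) ^ m) (val (indicator D)))
        (scaleY ((1 / 2) ^ m) (scaleY (1 / 2) (val (indicator P)))) < \<eta> / 2"
      using Y.dist_scale_scale D(2) by (metis le_less_trans)
    then have "dist (scaleY ((1 / 2) ^ m) (val (indicator D)))
        (scaleY ((1 / 2) ^ Suc m) (val (indicator P))) < \<eta> / 2"
      by (simp add: Y.scale_scale mult.commute)
    then have "dist (val (indicator B)) (scaleY ((1 / 2) ^ Suc m) (val (indicator P))) < \<eta>"
      if "B \<in> C" for B
      using C(4)[OF that] dist_triangle_half_r dist_commute by metis
    then show ?thesis
      using C by blast
  qed
  obtain C1 C2 where
    "finite C1" "C1 \<subseteq> sets M" "\<Union>C1 = D"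
    "\<forall>B\<in>C1. dist (val (indicator B)) (scaleY ((1 / 2) ^ Suc m) (val (indicator P))) < \<eta>"
    "finite C2" "C2 \<subseteq> sets M" "\<Union>C2 = E"
    "\<forall>B\<in>C2. dist (val (indicator B)) (scaleY ((1 / 2) ^ Suc m) (val (indicator P))) < \<eta>"
    using step[OF DE(1) D] step[OF DE(2) E] by blast
  then show ?case
    using P by (intro exI[of _ "C1 \<union> C2"]) auto
qed

lemma narrow_small_indicators:
  assumes "narrow M T" "P \<in> sets M" "\<delta> > 0"
  obtains C where "finite C" "C \<subseteq> sets M" "\<Union>C = P"
    "\<And>B. B \<in> C \<Longrightarrow> dist (val (indicator B)) 0 < \<delta>"
proof -
  \<comment> \<open>The number of halvings depends only on the vector
    \<open>val (indicator P)\<close>; the accuracy of the halvings is chosen independently of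
    it.\<close>
  obtain m where m: "dist (scaleY ((1 / 2) ^ m) (val (indicator P))) 0 < \<delta> / 2"
    using Y.scale_half_power_small[of "\<delta> / 2"] \<open>\<delta> > 0\<close> by auto
  obtain C where C: "finite C" "C \<subseteq> sets M" "\<Union>C = P"
    "\<And>B. B \<in> C \<Longrightarrow> dist (val (indicator B)) (scaleY ((1 / 2) ^ m) (val (indicator P))) < \<delta> / 2"
    using narrow_iterated_halving[OF assms(1,2), of "\<delta> / 2" m] \<open>\<delta> > 0\<close> by auto
  have "dist (val (indicator B)) 0 < \<delta>" if "B \<in> C" for B
    using C(4)[OF that] m dist_triangle[of "val (indicator B)" 0 "scaleY ((1 / 2) ^ m) (val (indicator P))"]
    by linarith
  with C show ?thesis
    using that by blast
qed

text \<open>Cutting the sets where \<open>f\<close> is 1 and where it is -1 separately makes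
  \<open>f\<close> constant on each piece. There \<open>f * indicator B\<close> is the indicator of
  \<open>B\<close> up to sign, and the F-norm ignores the sign.\<close>

lemma narrow_small_sign_pieces:
  assumes "narrow M T" and f: "sign_fun M f" and "\<delta> > 0"
  obtains C where "finite C" "C \<subseteq> sets M" "\<Union>C = {w \<in> space M. f w \<noteq> 0}"
    "\<And>B. B \<in> C \<Longrightarrow> dist (val (\<lambda>w. f w * indicator B w)) 0 < \<delta>"
proof -
  have [measurable]: "f \<in> borel_measurable M"
    using f by (rule sign_fun_measurable)
  have P: "{w \<in> space M. f w = 1} \<in> sets M" and Q: "{w \<in> space M. f w = - 1} \<in> sets M"
    by measurable
  obtain C1 where C1: "finite C1" "C1 \<subseteq> sets M" "\<Union>C1 = {w \<in> space M. f w = 1}"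
      "\<And>B. B \<in> C1 \<Longrightarrow> dist (val (indicator B)) 0 < \<delta>"
    using narrow_small_indicators[OF assms(1) P assms(3)] by blast
  obtain C2 where C2: "finite C2" "C2 \<subseteq> sets M" "\<Union>C2 = {w \<in> space M. f w = - 1}"
      "\<And>B. B \<in> C2 \<Longrightarrow> dist (val (indicator B)) 0 < \<delta>"
    using narrow_small_indicators[OF assms(1) Q assms(3)] by blast
  show ?thesis
  proof (rule that[of "C1 \<union> C2"])
    show "\<Union>(C1 \<union> C2) = {w \<in> space M. f w \<noteq> 0}"
      using C1(3) C2(3) f by (auto simp: sign_fun_def)
    show "dist (val (\<lambda>w. f w * indicator B w)) 0 < \<delta>" if "B \<in> C1 \<union> C2" for B
      using that
    proof
      assume B: "B \<in> C1"
      then have "f w = 1" if "w \<in> B" for w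
        using C1(3) that by blast
      then have "(\<lambda>w. f w * indicator B w) = indicator B"
        by (auto simp: indicator_def fun_eq_iff)
      then show ?thesis
        using C1(4)[OF B] by simp
    next
      assume B: "B \<in> C2"
      then have "f w = - 1" if "w \<in> B" for w
        using C2(3) that by blast
      then have "(\<lambda>w. f w * indicator B w) = (\<lambda>w. - indicator B w)"
        by (auto simp: indicator_def fun_eq_iff)
      then show ?thesis
        using C2(2,4) B by (auto simp: val_minus indicator_in_dom Y.dist_minus_zero)
    qed
  qed (use C1 C2 in auto)
qed

subsection \<open>Disjoint signs with large images\<close>

text \<open>The strict inequality is the exact negation of the bound wanted in the end, so any sign
  violating that bound is a candidate for enlarging a family.\<close>

definition large_family :: "real \<Rightarrow> nat \<Rightarrow> (nat \<Rightarrow> 'a \<Rightarrow> 'k) \<Rightarrow> bool" where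
  "large_family \<epsilon> N f \<longleftrightarrow>
     (\<forall>i<N. sign_fun M (f i) \<and> \<epsilon> < dist (val (f i)) 0) \<and>
     (\<forall>i<N. \<forall>j<N. i \<noteq> j \<longrightarrow> (\<forall>w. f i w = 0 \<or> f j w = 0))"

lemma sum_disjoint_signs:
  assumes "finite I" "\<And>i. i \<in> I \<Longrightarrow> sign_fun M (f i)"
    and disj: "\<And>i j w. i \<in> I \<Longrightarrow> j \<in> I \<Longrightarrow> i \<noteq> j \<Longrightarrow> f i w = 0 \<or> f j w = 0"
  shows "sign_fun M (\<lambda>w. \<Sum>i\<in>I. f i w)"
proof -
  have "(\<Sum>i\<in>I. f i w) \<in> {-1, 0, 1}" for w
  proof (cases "\<exists>i\<in>I. f i w \<noteq> 0")
    case True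
    then obtain i where i: "i \<in> I" "f i w \<noteq> 0"
      by blast
    then have "(\<Sum>j\<in>I - {i}. f j w) = 0"
      using disj by (intro sum.neutral) blast
    then have "(\<Sum>j\<in>I. f j w) = f i w"
      using assms(1) i by (simp add: sum.remove)
    then show ?thesis
      using assms(2)[OF i(1)] by (simp add: sign_fun_def)
  qed simp
  moreover have "(\<lambda>w. \<Sum>i\<in>I. f i w) \<in> borel_measurable M"
    using assms(2) by (intro borel_measurable_sum) (simp add: sign_fun_measurable)
  ultimately show ?thesis
    unfolding sign_fun_def by blast
qed

lemma large_family_bounded:
  assumes K: "compact (closure (T ` {x \<in> X. is_sign M x}))" and "\<epsilon> > 0"
  obtains b where "\<And>N f. large_family \<epsilon> N f \<Longrightarrow> N \<le> b"
proof -
  let ?K = "closure (T ` {x \<in> X. is_sign M x})"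
  have val_K: "val f \<in> ?K" if "sign_fun M f" for f
  proof -
    have "L0_class M f \<in> {x \<in> X. is_sign M x}"
      using sign_fun_in_dom[OF that] is_sign_L0_class[OF that] by (simp add: dom_def)
    then show ?thesis
      unfolding val_def by (intro subsetD[OF closure_subset] imageI)
  qed
  \<comment> \<open>\<open>n\<close> comes from \<open>K\<close> alone and must precede the radius:
    the sum of \<open>n\<close> vectors in one ball of radius \<open>r\<close> is within
    \<open>2 * n * r\<close> of \<open>n\<close> times any one of them, and \<open>r\<close> is then
    chosen to make this \<open>\<epsilon> / 2\<close>.\<close>
  obtain n where n: "n > 0" "\<And>s. s \<in> ?K \<Longrightarrow> dist (scaleY (1 / of_nat n) s) 0 < \<epsilon> / 2"
    using Y.compact_imp_scale_small[OF K, of "\<epsilon> / 2"] \<open>\<epsilon> > 0\<close> by auto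
  define r where "r = \<epsilon> / (4 * n)"
  have "r > 0"
    using n \<open>\<epsilon> > 0\<close> by (simp add: r_def)
  then obtain C where C: "finite C" "?K \<subseteq> (\<Union>c\<in>C. ball c r)"
    using K unfolding compact_eq_totally_bounded by blast
  have "N \<le> card C * n" if fam: "large_family \<epsilon> N f" for N f
  proof -
    have sgn: "sign_fun M (f i)" "dist (val (f i)) 0 > \<epsilon>" if "i < N" for i
      using fam that by (auto simp: large_family_def)
    have disj: "f i w = 0 \<or> f j w = 0" if "i < N" "j < N" "i \<noteq> j" for i j w
      using fam that by (auto simp: large_family_def)
    have small: "card {i \<in> {..<N}. val (f i) \<in> ball c r} \<le> n" for c
    proof (rule ccontr)
      assume "\<not> ?thesis"
      then have "n \<le> card {i \<in> {..<N}. val (f i) \<in> ball c r}"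
        by simp
      \<comment> \<open>Exactly \<open>n\<close> indices are kept, so that dividing the sum by
        \<open>n\<close> returns to \<open>z\<close>.\<close>
      then obtain I where I: "I \<subseteq> {i \<in> {..<N}. val (f i) \<in> ball c r}" "card I = n" "finite I"
        by (rule obtain_subset_with_card_n)
      then obtain k where k: "k \<in> I"
        using n(1) by fastforce
      have sgnI: "sign_fun M (f i)" if "i \<in> I" for i
        using I(1) sgn that by auto
      define z s where "z = val (f k)" and "s = (\<Sum>i\<in>I. val (f i))"
      have sum: "sign_fun M (\<lambda>w. \<Sum>i\<in>I. f i w)"
      proof (rule sum_disjoint_signs[OF I(3) sgnI])
        show "f i w = 0 \<or> f j w = 0" if "i \<in> I" "j \<in> I" "i \<noteq> j" for i j w
          using disj[of i j w] I(1) that by blast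
      qed
      have "s \<in> ?K"
        using val_K[OF sum] val_sum[of I f, OF I(3) sign_fun_in_dom[OF sgnI]] by (simp add: s_def)
      have "dist (val (f i)) z \<le> 2 * r" if "i \<in> I" for i
      proof -
        have "dist c (val (f i)) < r" "dist c z < r"
          using I(1) k that by (auto simp: z_def)
        then show ?thesis
          using dist_triangle3[of "val (f i)" z c] by simp
      qed
      then have "(\<Sum>i\<in>I. dist (val (f i)) z) \<le> n * (2 * r)"
        using sum_bounded_above[of I "\<lambda>i. dist (val (f i)) z" "2 * r"] I(2) by simp
      then have "dist s (\<Sum>i\<in>I. z) \<le> n * (2 * r)"
        using Y.dist_sum_sum[of "\<lambda>i. val (f i)" I "\<lambda>i. z"] by (simp add: s_def)
      then have "dist s (scaleY (of_nat n) z) \<le> \<epsilon> / 2"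
        using n(1) I Y.sum_constant_eq_scale[of I z] by (simp add: r_def)
      moreover have "norm (1 / of_nat n :: 'k) \<le> 1"
        using n(1) by (simp add: norm_divide)
      \<comment> \<open>Scaling by \<open>1 / n\<close> is nonexpansive, so \<open>z\<close> is
        within \<open>\<epsilon> / 2\<close> of \<open>s / n\<close>. Since \<open>s\<close> is in
        \<open>K\<close>, the choice of \<open>n\<close> puts \<open>s / n\<close> within
        \<open>\<epsilon> / 2\<close> of 0, contradicting the lower bound on
        \<open>z\<close>.\<close>
      ultimately have "dist (scaleY (1 / of_nat n) s) (scaleY (1 / of_nat n) (scaleY (of_nat n) z)) \<le> \<epsilon> / 2"
        using Y.dist_scale_scale order_trans by blast
      then have "dist (scaleY (1 / of_nat n) s) z \<le> \<epsilon> / 2"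
        using n(1) by (simp add: Y.scale_scale Y.scale_one)
      then have "dist z 0 < \<epsilon>"
        using n(2)[OF \<open>s \<in> ?K\<close>] dist_triangle3[of z 0 "scaleY (1 / of_nat n) s"] by linarith
      moreover have "dist z 0 > \<epsilon>"
        using sgn(2) I(1) k by (auto simp: z_def)
      ultimately show False
        by simp
    qed
    \<comment> \<open>Pigeonhole: the \<open>card C\<close> balls cover all images, and each
      contains at most \<open>n\<close> of them.\<close>
    have "{..<N} \<subseteq> (\<Union>c\<in>C. {i \<in> {..<N}. val (f i) \<in> ball c r})"
      using C(2) val_K sgn by blast
    then have "N \<le> card (\<Union>c\<in>C. {i \<in> {..<N}. val (f i) \<in> ball c r})"
      using C(1) card_mono[of "\<Union>c\<in>C. {i \<in> {..<N}. val (f i) \<in> ball c r}" "{..<N}"] by simp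
    also have "\<dots> \<le> (\<Sum>c\<in>C. card {i \<in> {..<N}. val (f i) \<in> ball c r})"
      using C(1) by (rule card_UN_le)
    also have "\<dots> \<le> card C * n"
      using sum_bounded_above[of C _ n] small by simp
    finally show ?thesis .
  qed
  then show ?thesis
    using that by blast
qed

section \<open>Maximal families and the finite cover they yield\<close>

lemma large_family_maximal:
  assumes "compact (closure (T ` {x \<in> X. is_sign M x}))" "\<epsilon> > 0"
  obtains N f where "large_family \<epsilon> N f" "\<And>g. \<not> large_family \<epsilon> (Suc N) g"
proof -
  obtain b where b: "\<And>N f. large_family \<epsilon> N f \<Longrightarrow> N \<le> b"
    using large_family_bounded[OF assms] by blast
  define N where "N = (GREATEST N. \<exists>f. large_family \<epsilon> N f)"
  \<comment> \<open>The empty family ensures that a greatest size exists.\<close>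
  have "\<exists>f. large_family \<epsilon> 0 f"
    by (simp add: large_family_def)
  then have "\<exists>f. large_family \<epsilon> N f"
    unfolding N_def by (rule GreatestI_nat) (use b in blast)
  moreover have "\<not> large_family \<epsilon> (Suc N) g" for g
    using Greatest_le_nat[of "\<lambda>N. \<exists>f. large_family \<epsilon> N f" "Suc N" b] b N_def by fastforce
  ultimately show ?thesis
    using that by blast
qed

lemma large_family_extend:
  assumes fam: "large_family \<epsilon> N f"
    and g: "sign_fun M g" "\<epsilon> < dist (val g) 0"
    and disj: "\<And>i w. i < N \<Longrightarrow> f i w = 0 \<or> g w = 0"
  shows "large_family \<epsilon> (Suc N) (f(N := g))"
  using assms unfolding large_family_def by (auto simp: less_Suc_eq)

text \<open>Removing \<open>B\<close> from the support of \<open>f j\<close> moves its image by the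
  F-norm of the removed part, which is less than the surplus over \<open>\<epsilon>\<close>. The
  member stays large, and \<open>f j\<close> no longer occupies \<open>B\<close>.\<close>

lemma large_family_cut:
  assumes fam: "large_family \<epsilon> N f" and j: "j < N" and B: "B \<in> sets M"
    and small: "dist (val (\<lambda>w. f j w * indicator B w)) 0 < dist (val (f j)) 0 - \<epsilon>"
  shows "large_family \<epsilon> N (f(j := \<lambda>w. f j w - f j w * indicator B w))"
proof -
  let ?p = "\<lambda>w. f j w * indicator B w" and ?h = "\<lambda>w. f j w - f j w * indicator B w"
  have fj: "sign_fun M (f j)"
    using fam j by (simp add: large_family_def)
  then have [measurable]: "f j \<in> borel_measurable M" "B \<in> sets M"
    using B by (auto simp: sign_fun_measurable)
  have p: "sign_fun M ?p"
    using fj unfolding sign_fun_def by (auto simp: indicator_def)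
  have h: "sign_fun M ?h"
    using fj unfolding sign_fun_def by (auto simp: indicator_def)
  have "val ?h = val (f j) - val ?p"
    by (intro val_diff sign_fun_in_dom fj p)
  then have "dist (val ?h) (val (f j)) = dist (val ?p) 0"
    using Y.dist_diff_zero[of "val ?h" "val (f j)"] by (simp add: Y.dist_minus_zero)
  then have "\<epsilon> < dist (val ?h) 0"
    using small dist_triangle3[of "val (f j)" 0 "val ?h"] by linarith
  then show ?thesis
    using fam h unfolding large_family_def by auto
qed

lemma finite_good_cover:
  assumes "narrow M T" "compact (closure (T ` {x \<in> X. is_sign M x}))" "\<epsilon> > 0"
  obtains C where "finite C" "C \<subseteq> sets M" "\<Union>C = space M"
    "\<And>B g. B \<in> C \<Longrightarrow> sign_fun M g \<Longrightarrow> (\<And>w. g w \<noteq> 0 \<Longrightarrow> w \<in> B) \<Longrightarrow> dist (val g) 0 \<le> \<epsilon>"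
proof -
  obtain N f where fam: "large_family \<epsilon> N f" and max: "\<And>g. \<not> large_family \<epsilon> (Suc N) g"
    using large_family_maximal[OF assms(2,3)] by blast
  have sgn: "sign_fun M (f j)" "dist (val (f j)) 0 > \<epsilon>" if "j < N" for j
    using fam that by (auto simp: large_family_def)
  \<comment> \<open>A large sign supported where all members vanish would extend the family
    directly, so \<open>R\<close> itself can serve as a set of the cover.\<close>
  define R where "R = {w \<in> space M. \<forall>j<N. f j w = 0}"
  have meas: "{w \<in> space M. f j w = 0} \<in> sets M" if "j < N" for j
    using sign_fun_measurable[OF sgn(1)[OF that]] by measurable
  have "R = space M \<inter> (\<Inter>j\<in>{..<N}. {w \<in> space M. f j w = 0})"
    by (cases "N = 0") (auto simp: R_def)
  then have R: "R \<in> sets M"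
    using meas by (cases "N = 0") auto
  define pieces where "pieces j C \<longleftrightarrow> finite C \<and> C \<subseteq> sets M \<and> \<Union>C = {w \<in> space M. f j w \<noteq> 0} \<and>
    (\<forall>B\<in>C. dist (val (\<lambda>w. f j w * indicator B w)) 0 < dist (val (f j)) 0 - \<epsilon>)" for j C
  have "\<exists>C. pieces j C" if j: "j < N" for j
  proof -
    have "dist (val (f j)) 0 - \<epsilon> > 0"
      using sgn(2)[OF j] by simp
    from assms(1) sgn(1)[OF j] this show ?thesis
    proof (rule narrow_small_sign_pieces)
      fix C
      assume "finite C" "C \<subseteq> sets M" "\<Union>C = {w \<in> space M. f j w \<noteq> 0}"
        and "\<And>B. B \<in> C \<Longrightarrow>
          dist (val (\<lambda>w. f j w * indicator B w)) 0 < dist (val (f j)) 0 - \<epsilon>"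
      then have "pieces j C"
        by (simp add: pieces_def)
      then show ?thesis ..
    qed
  qed
  then obtain C where "\<And>j. j < N \<Longrightarrow> pieces j (C j)"
    by metis
  then have C: "\<And>j. j < N \<Longrightarrow> finite (C j)" "\<And>j. j < N \<Longrightarrow> C j \<subseteq> sets M"
    "\<And>j. j < N \<Longrightarrow> \<Union>(C j) = {w \<in> space M. f j w \<noteq> 0}"
    "\<And>j B. j < N \<Longrightarrow> B \<in> C j \<Longrightarrow>
       dist (val (\<lambda>w. f j w * indicator B w)) 0 < dist (val (f j)) 0 - \<epsilon>"
    unfolding pieces_def by auto
  show ?thesis
  proof (rule that[of "insert R (\<Union>j<N. C j)"])
    have "\<Union>(insert R (\<Union>j<N. C j)) = R \<union> (\<Union>j<N. \<Union>(C j))"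
      by blast
    also have "\<dots> = space M"
      using C(3) by (auto simp: R_def)
    finally show "\<Union>(insert R (\<Union>j<N. C j)) = space M" .
  next
    fix B and g :: "'a \<Rightarrow> 'k"
    assume B: "B \<in> insert R (\<Union>j<N. C j)" and g: "sign_fun M g" "\<And>w. g w \<noteq> 0 \<Longrightarrow> w \<in> B"
    show "dist (val g) 0 \<le> \<epsilon>"
    proof (rule ccontr)
      assume "\<not> ?thesis"
      then have large: "\<epsilon> < dist (val g) 0"
        by simp
      from B show False
      proof
        assume "B = R"
        then have "f i w = 0 \<or> g w = 0" if "i < N" for i w
          using g(2)[of w] that by (auto simp: R_def)
        then show False
          using large_family_extend[OF fam g(1) large] max by blast
      next
        assume "B \<in> (\<Union>j<N. C j)"
        then obtain j where j: "j < N" "B \<in> C j"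
          by blast
        \<comment> \<open>The exchange: on \<open>B\<close> the modified member vanishes, and the
          other members vanish because \<open>B\<close> lies in the support of \<open>f j\<close>.
          So \<open>g\<close> can be appended, giving \<open>Suc N\<close> members.\<close>
        let ?f = "f(j := \<lambda>w. f j w - f j w * indicator B w)"
        have "B \<in> sets M"
          using C(2) j by blast
        then have fam': "large_family \<epsilon> N ?f"
          using large_family_cut[OF fam j(1)] C(4)[OF j] by blast
        have "?f i w = 0 \<or> g w = 0" if "i < N" for i w
        proof (cases "g w = 0")
          case False
          then have "w \<in> B"
            by (rule g(2))
          then have "f j w \<noteq> 0"
            using C(3)[OF j(1)] j(2) by blast
          then have "i \<noteq> j \<Longrightarrow> f i w = 0"
            using fam j(1) that unfolding large_family_def by blast
          then show ?thesis
            using \<open>w \<in> B\<close> by auto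
        qed simp
        then show False
          using large_family_extend[OF fam' g(1) large] max by blast
      qed
    qed
  qed (use C R in auto)
qed

end

section \<open>From a finite cover to a partition\<close>

lemma finite_cover_refine_partition:
  assumes "finite C" "C \<noteq> {}" "C \<subseteq> sets M" "\<Union>C = space M"
  obtains n and A :: "nat \<Rightarrow> 'a set" where "n \<ge> 1" "\<And>k. k \<in> {1..n} \<Longrightarrow> A k \<in> sets M"
    "disjoint_family_on A {1..n}" "(\<Union>k\<in>{1..n}. A k) = space M"
    "\<And>k. k \<in> {1..n} \<Longrightarrow> \<exists>B\<in>C. A k \<subseteq> B"
proof -
  obtain h where h: "bij_betw h {1..card C} C"
    using ex_bij_betw_nat_finite_1[OF assms(1)] by blast
  have hC: "h k \<in> C" if "k \<in> {1..card C}" for k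
    using h that by (auto simp: bij_betw_def)
  define A where "A k = h k - (\<Union>j\<in>{1..<k}. h j)" for k
  show ?thesis
  proof (rule that)
    show "1 \<le> card C"
      using assms(1,2) by (simp add: Suc_le_eq card_gt_0_iff)
    show "A k \<in> sets M" if "k \<in> {1..card C}" for k
      using that hC assms(3) unfolding A_def by (intro sets.Diff sets.finite_UN) auto
    show "disjoint_family_on A {1..card C}"
      unfolding disjoint_family_on_def A_def
    proof (intro ballI impI)
      fix k l assume "k \<in> {1..card C}" "l \<in> {1..card C}" "k \<noteq> l"
      then have "k \<in> {1..<l} \<or> l \<in> {1..<k}"
        by auto
      then show "(h k - (\<Union>j\<in>{1..<k}. h j)) \<inter> (h l - (\<Union>j\<in>{1..<l}. h j)) = {}"
        by blast
    qed
    show "(\<Union>k\<in>{1..card C}. A k) = space M"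
    proof
      show "(\<Union>k\<in>{1..card C}. A k) \<subseteq> space M"
        using hC assms(4) unfolding A_def by blast
      show "space M \<subseteq> (\<Union>k\<in>{1..card C}. A k)"
      proof
        fix w assume "w \<in> space M"
        then obtain B where "B \<in> h ` {1..card C}" "w \<in> B"
          using assms(4) bij_betw_imp_surj_on[OF h] by blast
        then obtain k where k: "k \<in> {1..card C} \<and> w \<in> h k"
          by blast
        \<comment> \<open>The first set of the enumeration containing \<open>w\<close> is the one
          from which \<open>w\<close> is not subtracted.\<close>
        define l where "l = (LEAST k. k \<in> {1..card C} \<and> w \<in> h k)"
        have l: "l \<in> {1..card C} \<and> w \<in> h l"
          unfolding l_def using k by (rule LeastI)
        have "w \<notin> h j" if j: "j \<in> {1..<l}" for j
        proof -
          have "\<not> (j \<in> {1..card C} \<and> w \<in> h j)"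
            by (rule not_less_Least) (use j l_def in simp)
          then show ?thesis
            using j l by auto
        qed
        then show "w \<in> (\<Union>k\<in>{1..card C}. A k)"
          using l unfolding A_def by blast
      qed
    qed
    show "\<exists>B\<in>C. A k \<subseteq> B" if "k \<in> {1..card C}" for k
      using hC[OF that] unfolding A_def by blast
  qed
qed

theorem proposition3p1:
  fixes M :: "'a measure"
    and X :: "('a \<Rightarrow> 'k::{real_normed_field,euclidean_space}) set set"
    and d :: "('a \<Rightarrow> 'k) set \<Rightarrow> ('a \<Rightarrow> 'k) set \<Rightarrow> real"
    and scaleY :: "'k \<Rightarrow> 'y \<Rightarrow> 'y::{ab_group_add,metric_space}"
    and T :: "('a \<Rightarrow> 'k) set \<Rightarrow> 'y"
    and \<epsilon> :: real
  assumes "finite_measure M"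
    and "atomless M"
    and "Koethe_F_space M X d"
    and "F_space (UNIV :: 'y set) dist (+) 0 scaleY"
    and "continuous_linear_operator M X d scaleY T"
    and "narrow M T"
    and "compact (closure (T ` {x \<in> X. is_sign M x}))"
    and "\<epsilon> > 0"
  shows "\<exists>n::nat. \<exists>A :: nat \<Rightarrow> 'a set. n \<ge> 1 \<and>
           (\<forall>k\<in>{1..n}. A k \<in> sets M) \<and>
           disjoint_family_on A {1..n} \<and>
           (\<Union>k\<in>{1..n}. A k) = space M \<and>
           (\<forall>k\<in>{1..n}. \<forall>x. is_sign M x \<and> L0_supp_subset M x (A k) \<longrightarrow> dist (T x) 0 \<le> \<epsilon>)"
proof -
  interpret Koethe_operator M X d scaleY T
    by (intro Koethe_operator.intro F_space_type.intro Koethe_operator_axioms.intro assms)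
  obtain C where C: "finite C" "C \<subseteq> sets M" "\<Union>C = space M"
    and good: "\<And>B g. B \<in> C \<Longrightarrow> sign_fun M g \<Longrightarrow> (\<And>w. g w \<noteq> 0 \<Longrightarrow> w \<in> B) \<Longrightarrow> dist (val g) 0 \<le> \<epsilon>"
    using finite_good_cover[OF assms(6-8)] by metis
  \<comment> \<open>When \<open>space M\<close> is empty, \<open>C\<close> may be empty too; adding
    the empty set guarantees \<open>n \<ge> 1\<close>.\<close>
  have "insert {} C \<noteq> {}" "finite (insert {} C)" "insert {} C \<subseteq> sets M" "\<Union>(insert {} C) = space M"
    using C by auto
  then obtain n and A :: "nat \<Rightarrow> 'a set" where A: "n \<ge> 1" "\<And>k. k \<in> {1..n} \<Longrightarrow> A k \<in> sets M"
    "disjoint_family_on A {1..n}" "(\<Union>k\<in>{1..n}. A k) = space M"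
    "\<And>k. k \<in> {1..n} \<Longrightarrow> \<exists>B\<in>insert {} C. A k \<subseteq> B"
    using finite_cover_refine_partition by metis
  have "dist (T x) 0 \<le> \<epsilon>"
    if k: "k \<in> {1..n}" and x: "is_sign M x" "L0_supp_subset M x (A k)" for k x
  proof -
    obtain f where f: "sign_fun M f" "x = L0_class M f" "\<And>w. f w \<noteq> 0 \<Longrightarrow> w \<in> A k"
      using is_sign_obtain[OF x A(2)[OF k]] by blast
    obtain B where B: "B \<in> insert {} C" "A k \<subseteq> B"
      using A(5)[OF k] by blast
    show ?thesis
    proof (cases "B \<in> C")
      case True
      then show ?thesis
        using good[OF _ f(1)] B(2) f(2,3) unfolding val_def by blast
    next
      case False
      \<comment> \<open>Here \<open>B\<close> is the added empty set, and a function supported in it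
        vanishes identically.\<close>
      then have "f = (\<lambda>w. 0)"
        using B f(3) by auto
      then show ?thesis
        using f(2) val_zero \<open>\<epsilon> > 0\<close> by (simp add: val_def)
    qed
  qed
  then show ?thesis
    using A(1-4) by blast
qed

end
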